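(* Let $T$ be a finite tree on at least two vertices. Let $Q_1,\dots,Q_k$ be all the diametrical paths in $T$, and for each $i\in\{1,\dots,k\}$ let $T_i$ be the tree induced from the path $Q_i$. Then $$E(T)=\bigcup_{i=1}^k E(T_i),$$ where $E(\cdot)$ denotes the eccentric graph and the union of graphs is the graph whose vertex set and edge set are the unions of the vertex sets and of the edge sets, respectively.
   Context: For a connected simple graph $G$, $d_G$ is the graph distance and $e_G(v)=\max\{d_G(u,v):u\in V(G)\}$. A vertex $u$ is eccentric to $v$ if $d_G(u,v)=e_G(v)$. The eccentric graph $E(G)$ is the simple graph on vertex set $V(G)$ in which two distinct vertices $u,v$ are adjacent iff $u$ is eccentric to $v$ or $v$ is eccentric to $u$. A diametrical path in a tree $T$ is a path of length $\mathrm{diam}(T)$, i.e. a longest path; a path and its reversal are regarded as the same path. For a leaf $v$ of a tree $T$, the stem at $v$ is the path from $v$ to the nearest vertex of degree greater than two (a path graph has no stems). Removing the stem at $v$ means deleting all vertices of the stem except its endpoint of degree greater than two, which is kept. For a diametrical path $P$ in $T$, the tree induced from $P$ is the subtree of $T$ obtained by removing the stems at all those leaves of $T$ which are not endpoints of $P$ but are an endpoint of some diametrical path of $T$ other than $P$. *)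

theory Defs
  imports "Graph_Theory.Graph_Theory"
begin

text \<open>
  A finite simple graph is a symmetric digraph satisfying the locale \<open>graph\<close>. In such a
  graph every edge is traversed back and forth by a closed walk of length 2, which \<open>cycle\<close>
  accepts. Hence the library predicates \<open>forest\<close> and \<open>tree\<close> fail as soon as there is an edge,
  and only cycles of length at least 3 are forbidden here.
\<close>

definition undirected_tree :: "('a, 'b) pre_digraph \<Rightarrow> bool" where
  "undirected_tree T \<longleftrightarrow>
     graph T \<and> connected T \<and> \<not> (\<exists>c. pre_digraph.cycle T c \<and> length c \<ge> 3)"

definition graph_dist :: "('a, 'b) pre_digraph \<Rightarrow> 'a \<Rightarrow> 'a \<Rightarrow> ereal" where
  "graph_dist G u v = wf_digraph.\<mu> G (\<lambda>_. 1) u v"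

definition eccentricity :: "('a, 'b) pre_digraph \<Rightarrow> 'a \<Rightarrow> ereal" where
  "eccentricity G v = Max ((\<lambda>u. graph_dist G u v) ` verts G)"

definition diameter :: "('a, 'b) pre_digraph \<Rightarrow> ereal" where
  "diameter G = Max (eccentricity G ` verts G)"

definition eccentric_to :: "('a, 'b) pre_digraph \<Rightarrow> 'a \<Rightarrow> 'a \<Rightarrow> bool" where
  "eccentric_to G u v \<longleftrightarrow> graph_dist G u v = eccentricity G v"

definition eccentric_graph :: "('a, 'b) pre_digraph \<Rightarrow> 'a pair_pre_digraph" where
  "eccentric_graph G =
     \<lparr> pverts = verts G,
       parcs = {(u, v). u \<in> verts G \<and> v \<in> verts G \<and> u \<noteq> v \<and>
                  (eccentric_to G u v \<or> eccentric_to G v u)} \<rparr>"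

definition pair_Union :: "'a pair_pre_digraph set \<Rightarrow> 'a pair_pre_digraph" where
  "pair_Union \<G> = \<lparr> pverts = (\<Union>G\<in>\<G>. pverts G), parcs = (\<Union>G\<in>\<G>. parcs G) \<rparr>"

text \<open>
  Paths are vertex lists, so an undirected path with at least one edge is represented by exactly
  two lists, each the reversal of the other.
\<close>

definition diametrical_path :: "('a, 'b) pre_digraph \<Rightarrow> 'a vwalk \<Rightarrow> bool" where
  "diametrical_path T P \<longleftrightarrow> vpath P T \<and> ereal (real (vwalk_length P)) = diameter T"

text \<open>Since the arcs are symmetric, the degree of a vertex is its \<open>out_degree\<close>.\<close>

definition leaf :: "('a, 'b) pre_digraph \<Rightarrow> 'a \<Rightarrow> bool" where
  "leaf T v \<longleftrightarrow> v \<in> verts T \<and> out_degree T v = 1"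

definition branch_vertex :: "('a, 'b) pre_digraph \<Rightarrow> 'a \<Rightarrow> bool" where
  "branch_vertex T v \<longleftrightarrow> v \<in> verts T \<and> out_degree T v > 2"

text \<open>
  A relation rather than a function: if there is no branch vertex, no list is a stem, and
  nothing is removed below.
\<close>

definition is_stem :: "('a, 'b) pre_digraph \<Rightarrow> 'a \<Rightarrow> 'a vwalk \<Rightarrow> bool" where
  "is_stem T v S \<longleftrightarrow>
     vpath S T \<and> hd S = v \<and> branch_vertex T (last S) \<and>
     (\<forall>w. branch_vertex T w \<longrightarrow> graph_dist T v (last S) \<le> graph_dist T v w)"

definition removed_leaves :: "('a, 'b) pre_digraph \<Rightarrow> 'a vwalk \<Rightarrow> 'a set" where
  "removed_leaves T P =
     {v. leaf T v \<and> v \<notin> {hd P, last P} \<and>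
         (\<exists>Q. diametrical_path T Q \<and> Q \<noteq> P \<and> Q \<noteq> rev P \<and> v \<in> {hd Q, last Q})}"

text \<open>
  All stems are taken in the original tree and removed simultaneously; \<open>butlast\<close> keeps the
  branch vertex at which a stem ends.
\<close>

definition induced_tree :: "('a, 'b) pre_digraph \<Rightarrow> 'a vwalk \<Rightarrow> ('a, 'b) pre_digraph" where
  "induced_tree T P =
     T \<restriction> (verts T - \<Union> {set (butlast S) |v S. v \<in> removed_leaves T P \<and> is_stem T v S})"

end

theory Submission
  imports Defs
begin

text \<open>
  Distances in a tree satisfy the four-point condition. Hence, if \<open>a\<close> and \<open>b\<close> are the ends of a
  diametrical path \<open>P\<close>, the eccentricity of every vertex \<open>u\<close> is the larger of its distances to
  \<open>a\<close> and \<open>b\<close>, and every vertex that is eccentric to some vertex ends a diametrical path.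
  Removing stems leaves a geodesically convex set that contains \<open>a\<close> and \<open>b\<close>, so the tree
  induced from \<open>P\<close> has the distances and eccentricities of \<open>T\<close>. What remains is to find,
  for \<open>u\<close> eccentric to \<open>v\<close>, a diametrical path whose induced tree contains both. If \<open>v\<close> is on
  the stem of a leaf \<open>w\<close> that ends a diametrical path, then the path from \<open>u\<close> to \<open>w\<close> will do, as
  it passes through \<open>v\<close> and is diametrical; otherwise any diametrical path that ends in \<open>u\<close> will.
\<close>

section \<open>Trees as integral metric spaces\<close>

text \<open>
  Acyclicity enters only through \<open>nearer_unique\<close>: seen from \<open>v\<close>, every vertex \<open>u\<close> has at
  most one neighbour that is not farther away, namely its predecessor.
\<close>

locale tree_metric =
  fixes V :: "'a set" and E :: "('a \<times> 'a) set" and d :: "'a \<Rightarrow> 'a \<Rightarrow> nat"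
  assumes finite_V: "finite V"
    and adj_in_V: "(x, y) \<in> E \<Longrightarrow> x \<in> V \<and> y \<in> V"
    and adj_sym: "(x, y) \<in> E \<Longrightarrow> (y, x) \<in> E"
    and dist_zero: "x \<in> V \<Longrightarrow> y \<in> V \<Longrightarrow> d x y = 0 \<longleftrightarrow> x = y"
    and dist_sym: "x \<in> V \<Longrightarrow> y \<in> V \<Longrightarrow> d x y = d y x"
    and dist_tri: "x \<in> V \<Longrightarrow> y \<in> V \<Longrightarrow> z \<in> V \<Longrightarrow> d x z \<le> d x y + d y z"
    and dist_adj: "(x, y) \<in> E \<Longrightarrow> d x y = 1"
    and dist_pred: "u \<in> V \<Longrightarrow> s \<in> V \<Longrightarrow> u \<noteq> s \<Longrightarrow> \<exists>x. (x, s) \<in> E \<and> Suc (d u x) = d u s"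
    and nearer_unique: "v \<in> V \<Longrightarrow> (u, x) \<in> E \<Longrightarrow> (u, y) \<in> E \<Longrightarrow>
      d v x \<le> d v u \<Longrightarrow> d v y \<le> d v u \<Longrightarrow> x = y"
begin

text \<open>Equal distances are impossible: by \<open>nearer_unique\<close>, \<open>x\<close> would
  coincide with the predecessor of \<open>u\<close> on the way from \<open>v\<close>, which is
  strictly nearer.\<close>

lemma adj_dist_cases:
  assumes "v \<in> V" "(u, x) \<in> E"
  shows "d v x = Suc (d v u) \<or> Suc (d v x) = d v u"
proof -
  have V: "u \<in> V" "x \<in> V" using assms adj_in_V by auto
  have "d v x \<le> Suc (d v u)" "d v u \<le> Suc (d v x)"
    using dist_tri[of v u x] dist_tri[of v x u] dist_adj assms V adj_sym[of u x] by fastforce+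
  moreover have "d v x \<noteq> d v u"
  proof
    assume eq: "d v x = d v u"
    have "v \<noteq> u"
    proof
      assume "v = u"
      then have "d v x = 0" using eq dist_zero V by auto
      then show False using \<open>v = u\<close> dist_adj[OF assms(2)] by simp
    qed
    then obtain y where y: "(y, u) \<in> E" "Suc (d v y) = d v u"
      using dist_pred assms V by blast
    then have "y = x" using nearer_unique[of v u y x] assms eq adj_sym by simp
    then show False using y eq by simp
  qed
  ultimately show ?thesis by linarith
qed

section \<open>Paths, projections and the four-point condition\<close>

definition path :: "'a list \<Rightarrow> bool" where
  "path p \<longleftrightarrow> p \<noteq> [] \<and> set p \<subseteq> V \<and> distinct p \<and>
     (\<forall>i. Suc i < length p \<longrightarrow> (p ! i, p ! Suc i) \<in> E)"

lemma path_nth_in_V: "path p \<Longrightarrow> i < length p \<Longrightarrow> p ! i \<in> V"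
  unfolding path_def using nth_mem by blast

text \<open>Once a path moves away from \<open>z\<close> it does so to its end. After a step up, the
  vertex just left is the only neighbour that is not farther, and a path does not return to
  it.\<close>

lemma path_ascent:
  assumes p: "path p" and z: "z \<in> V" and up: "d z (p ! i) < d z (p ! Suc i)"
    and "i + k < length p"
  shows "d z (p ! (i + k)) = d z (p ! i) + k"
proof -
  have adj: "(p ! j, p ! Suc j) \<in> E" if "Suc j < length p" for j
    using p that unfolding path_def by auto
  \<comment> \<open>The induction also carries that the next step, if there is one, goes up; this
    identifies the previous vertex as the nearer neighbour.\<close>
  have "d z (p ! (i + k)) = d z (p ! i) + k \<and>
      (Suc (i + k) < length p \<longrightarrow> d z (p ! Suc (i + k)) = Suc (d z (p ! (i + k))))"
    using assms(4)
  proof (induction k)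
    case 0
    then show ?case using adj_dist_cases[OF z adj[of i]] up by auto
  next
    case (Suc k)
    let ?j = "i + k"
    have IH: "d z (p ! ?j) = d z (p ! i) + k" "d z (p ! Suc ?j) = Suc (d z (p ! ?j))"
      using Suc by auto
    have "d z (p ! Suc (Suc ?j)) = Suc (d z (p ! Suc ?j))" if l: "Suc (Suc ?j) < length p"
    proof (rule ccontr)
      assume "d z (p ! Suc (Suc ?j)) \<noteq> Suc (d z (p ! Suc ?j))"
      then have "d z (p ! Suc (Suc ?j)) \<le> d z (p ! Suc ?j)"
        using adj_dist_cases[OF z adj[OF l]] by auto
      then have "p ! Suc (Suc ?j) = p ! ?j"
        using nearer_unique[OF z adj[OF l], of "p ! ?j"] adj[of ?j] adj_sym IH l by simp
      then show False
        using p l nth_eq_iff_index_eq[of p "Suc (Suc ?j)" ?j] unfolding path_def by auto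
    qed
    then show ?case using IH by simp
  qed
  then show ?thesis by blast
qed

text \<open>Seen from \<open>p ! i\<close> the first step goes up, so \<open>path_ascent\<close>
  applies with \<open>z\<close> taken as \<open>p ! i\<close>: every path is a geodesic.\<close>

lemma path_dist:
  assumes p: "path p" and "i \<le> j" "j < length p"
  shows "d (p ! i) (p ! j) = j - i"
proof (cases "i = j")
  case True
  then show ?thesis using assms path_nth_in_V dist_zero by simp
next
  case False
  then have "(p ! i, p ! Suc i) \<in> E" using p assms unfolding path_def by auto
  then have "d (p ! i) (p ! Suc i) = 1" by (rule dist_adj)
  moreover have "p ! i \<in> V" using assms path_nth_in_V by simp
  moreover from this have "d (p ! i) (p ! i) = 0" using dist_zero by simp
  ultimately show ?thesis
    using path_ascent[OF p, of "p ! i" i "j - i"] assms by simp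
qed

lemma path_dist_ends: "path p \<Longrightarrow> d (hd p) (last p) = length p - 1"
  using path_dist[of p 0 "length p - 1"] by (simp add: path_def hd_conv_nth last_conv_nth)

text \<open>The bound on the distances serves the induction: it keeps \<open>y\<close> off the path
  already built to its predecessor, which is nearer to \<open>x\<close>.\<close>

lemma path_exists:
  assumes "x \<in> V" "y \<in> V"
  shows "\<exists>p. path p \<and> hd p = x \<and> last p = y \<and> (\<forall>z\<in>set p. d x z \<le> d x y)"
  using assms(2)
proof (induction "d x y" arbitrary: y)
  case 0
  then have "x = y" using dist_zero assms by auto
  then show ?case using assms by (intro exI[of _ "[x]"]) (auto simp: path_def)
next
  case (Suc n)
  then have "x \<noteq> y" using dist_zero[of x y] assms by auto
  then obtain w where w: "(w, y) \<in> E" "Suc (d x w) = d x y"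
    using dist_pred assms Suc by blast
  then obtain p where p: "path p" "hd p = x" "last p = w" "\<forall>z\<in>set p. d x z \<le> d x w"
    using Suc.hyps(1)[of w] Suc.hyps(2) adj_in_V by auto
  have "y \<notin> set p" using p w by auto
  moreover have "((p @ [y]) ! i, (p @ [y]) ! Suc i) \<in> E" if "Suc i < length (p @ [y])" for i
  proof (cases "Suc i = length p")
    case True
    then have "p ! i = w" using p by (simp add: path_def last_conv_nth flip: True)
    then show ?thesis using True w by (simp add: nth_append flip: True)
  next
    case False
    then show ?thesis using that p by (simp add: path_def nth_append)
  qed
  ultimately have "path (p @ [y])" using p Suc.prems unfolding path_def by auto
  then show ?case using p w by (intro exI[of _ "p @ [y]"]) (auto simp: path_def)
qed

text \<open>The vertex \<open>p ! j\<close> is one nearest to \<open>z\<close>, and the distance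
  grows by one per step in both directions. With truncated subtraction,
  \<open>(i - j) + (j - i)\<close> is the absolute difference.\<close>

lemma path_projection:
  assumes p: "path p" and z: "z \<in> V"
  shows "\<exists>j<length p. \<forall>i<length p. d z (p ! i) = d z (p ! j) + (i - j) + (j - i)"
proof -
  have "0 < length p" using p by (simp add: path_def)
  then obtain j where j: "j < length p"
    and min: "\<And>i. i < length p \<Longrightarrow> d z (p ! j) \<le> d z (p ! i)"
    using ex_has_least_nat[of "\<lambda>i. i < length p" 0 "\<lambda>i. d z (p ! i)"] by blast
  have adj: "(p ! i, p ! Suc i) \<in> E" if "Suc i < length p" for i
    using p that unfolding path_def by auto
  have above: "d z (p ! (j + k)) = d z (p ! j) + k" if "j + k < length p" for k
  proof (cases "k = 0")
    case False
    then have "Suc j < length p" using that by simp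
    then have "d z (p ! j) < d z (p ! Suc j)"
      using adj_dist_cases[OF z adj] min[of "Suc j"] by fastforce
    then show ?thesis using path_ascent[OF p z] that by blast
  qed simp
  \<comment> \<open>A step up before \<open>j\<close> would continue up to \<open>j\<close>, making
    \<open>p ! i\<close> nearer to \<open>z\<close> than the minimum.\<close>
  have down: "d z (p ! i) = Suc (d z (p ! Suc i))" if "i < j" for i
  proof (rule ccontr)
    assume "d z (p ! i) \<noteq> Suc (d z (p ! Suc i))"
    then have "d z (p ! i) < d z (p ! Suc i)"
      using adj_dist_cases[OF z adj[of i]] j that by auto
    then have "d z (p ! j) = d z (p ! i) + (j - i)"
      using path_ascent[OF p z, of i "j - i"] that j by simp
    then show False using min[of i] that j by simp
  qed
  have below: "d z (p ! (j - k)) = d z (p ! j) + k" if "k \<le> j" for k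
    using that
  proof (induction k)
    case (Suc k)
    then show ?case using down[of "j - Suc k"] by (simp add: Suc_diff_Suc)
  qed simp
  have "d z (p ! i) = d z (p ! j) + (i - j) + (j - i)" if "i < length p" for i
    using above[of "i - j"] below[of "j - i"] that by (cases "i \<le> j") auto
  then show ?thesis using j by blast
qed

text \<open>Project \<open>z\<close> and \<open>w\<close> to the path from \<open>x\<close> to
  \<open>y\<close>, at positions \<open>j\<close> and \<open>k\<close>. The cross distances are then
  explicit, and \<open>d z w\<close> is at most the two distances to the path plus the gap between
  \<open>j\<close> and \<open>k\<close>. The order of \<open>j\<close> and \<open>k\<close> decides
  which sum on the right dominates.\<close>

lemma four_point:
  assumes "x \<in> V" "y \<in> V" "z \<in> V" "w \<in> V"
  shows "d x y + d z w \<le> max (d x z + d y w) (d x w + d y z)"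
proof -
  obtain p where p: "path p" "hd p = x" "last p = y" using path_exists assms by blast
  define n where "n = length p - 1"
  have n: "n < length p" "0 < length p" "p ! 0 = x" "p ! n = y"
    using p by (auto simp: n_def path_def hd_conv_nth last_conv_nth)
  obtain j where j: "j < length p" "\<And>i. i < length p \<Longrightarrow> d z (p ! i) = d z (p ! j) + (i - j) + (j - i)"
    using path_projection[OF p(1) assms(3)] by blast
  obtain k where k: "k < length p" "\<And>i. i < length p \<Longrightarrow> d w (p ! i) = d w (p ! k) + (i - k) + (k - i)"
    using path_projection[OF p(1) assms(4)] by blast
  have xy: "d x y = n" using path_dist[OF p(1), of 0 n] n by simp
  have z: "d x z = d z (p ! j) + j" "d y z = d z (p ! j) + (n - j)"
    using j(2)[OF n(2)] j(2)[OF n(1)] n(3,4) j(1) dist_sym[of z] assms by (simp_all add: n_def)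
  have w: "d x w = d w (p ! k) + k" "d y w = d w (p ! k) + (n - k)"
    using k(2)[OF n(2)] k(2)[OF n(1)] n(3,4) k(1) dist_sym[of w] assms by (simp_all add: n_def)
  have jk: "p ! j \<in> V" "p ! k \<in> V" using j k p path_nth_in_V by auto
  have "d z w \<le> d z (p ! j) + d (p ! j) (p ! k) + d w (p ! k)"
    using dist_tri[of z "p ! j" w] dist_tri[of "p ! j" "p ! k" w] dist_sym assms jk by fastforce
  moreover have "d (p ! j) (p ! k) = (j - k) + (k - j)"
    using path_dist[OF p(1), of j k] path_dist[OF p(1), of k j] j(1) k(1) dist_sym jk
    by (cases "j \<le> k") auto
  moreover have "j \<le> n" "k \<le> n" using j(1) k(1) by (auto simp: n_def)
  ultimately show ?thesis unfolding xy z w by (cases "j \<le> k") auto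
qed

section \<open>Diametral pairs and farthest vertices\<close>

definition diametral :: "'a \<Rightarrow> 'a \<Rightarrow> bool" where
  "diametral a b \<longleftrightarrow> a \<in> V \<and> b \<in> V \<and> (\<forall>x\<in>V. \<forall>y\<in>V. d x y \<le> d a b)"

lemma diametral_exists:
  assumes "V \<noteq> {}"
  shows "\<exists>a b. diametral a b"
proof -
  let ?D = "(\<lambda>(x, y). d x y) ` (V \<times> V)"
  have fin: "finite ?D" "?D \<noteq> {}" using finite_V assms by auto
  have "Max ?D \<in> ?D" using fin by (rule Max_in)
  then obtain a b where ab: "a \<in> V" "b \<in> V" "d a b = Max ?D" by force
  moreover have "d x y \<le> Max ?D" if "x \<in> V" "y \<in> V" for x y
    using that fin(1) by (intro Max_ge) auto
  ultimately show ?thesis unfolding diametral_def by metis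
qed

text \<open>In the four-point condition for \<open>u\<close>, \<open>x\<close>, \<open>a\<close>,
  \<open>b\<close>, the distances from \<open>x\<close> to \<open>a\<close> and \<open>b\<close> are
  at most \<open>d a b\<close>, which cancels.\<close>

lemma dist_le_max_diametral:
  assumes "diametral a b" "u \<in> V" "x \<in> V"
  shows "d u x \<le> max (d u a) (d u b)"
proof -
  have "a \<in> V" "b \<in> V" "d x a \<le> d a b" "d x b \<le> d a b"
    using assms by (auto simp: diametral_def)
  then show ?thesis using four_point[of u x a b] assms by auto
qed

text \<open>In the four-point condition for \<open>a\<close>, \<open>b\<close>, \<open>u\<close>,
  \<open>v\<close>, the distances from \<open>v\<close> to \<open>a\<close> and \<open>b\<close> are
  at most \<open>d u v\<close>. Cancelling it shows that \<open>u\<close> is at least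
  \<open>d a b\<close> away from \<open>a\<close> or from \<open>b\<close>, which then serves as
  \<open>c\<close>.\<close>

lemma farthest_diametral:
  assumes "diametral a b" "u \<in> V" "v \<in> V" "\<forall>x\<in>V. d v x \<le> d v u"
  shows "\<exists>c. diametral u c"
proof -
  have ab: "a \<in> V" "b \<in> V" "d v a \<le> d v u" "d v b \<le> d v u"
    using assms by (auto simp: diametral_def)
  have sym: "d u v = d v u" "d a v = d v a" "d b v = d v b" "d a u = d u a" "d b u = d u b"
    using dist_sym ab assms by blast+
  have "d a b \<le> d u a \<or> d a b \<le> d u b"
    using four_point[OF ab(1,2) assms(2,3)] ab(3,4) unfolding sym by linarith
  moreover have "diametral u c" if "c \<in> V" "d a b \<le> d u c" for c
    using assms(1,2) that order_trans unfolding diametral_def by blast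
  ultimately show ?thesis using ab by blast
qed

text \<open>No neighbour of a farthest vertex is farther, so \<open>nearer_unique\<close> leaves at
  most one of them.\<close>

lemma farthest_neighbour_unique:
  assumes "v \<in> V" "\<forall>x\<in>V. d v x \<le> d v u" "(u, x) \<in> E" "(u, y) \<in> E"
  shows "x = y"
  using nearer_unique[of v u x y] assms adj_in_V by blast

section \<open>Stems in terms of distances\<close>

text \<open>Degrees one and two are expressed by listing the possible neighbours. Hence the vertices
  of \<open>butlast S\<close> are joined to the rest only through \<open>last S\<close>, which
  itself may have any neighbours.\<close>

definition stem :: "'a list \<Rightarrow> bool" where
  "stem S \<longleftrightarrow> path S \<and> 2 \<le> length S \<and> (\<forall>x. (hd S, x) \<in> E \<longrightarrow> x = S ! 1) \<and>
     (\<forall>i x. Suc (Suc i) < length S \<longrightarrow> (S ! Suc i, x) \<in> E \<longrightarrow> x = S ! i \<or> x = S ! Suc (Suc i))"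

lemma set_butlast_conv_nth: "x \<in> set (butlast S) \<longleftrightarrow> (\<exists>i. Suc i < length S \<and> x = S ! i)"
proof -
  have "x \<in> set (butlast S) \<longleftrightarrow> (\<exists>i<length S - 1. butlast S ! i = x)"
    by (simp add: in_set_conv_nth)
  also have "\<dots> \<longleftrightarrow> (\<exists>i. Suc i < length S \<and> x = S ! i)"
    using nth_butlast[of _ S] by (metis Suc_eq_plus1 length_butlast less_diff_conv)
  finally show ?thesis .
qed

text \<open>The predecessor of \<open>S ! i\<close> as seen from \<open>u\<close> is one of its
  neighbours on the stem. It is not \<open>S ! (i - 1)\<close>, which is farther by induction, so it
  is the next vertex.\<close>

lemma stem_dist_Suc:
  assumes S: "stem S" and u: "u \<in> V" "u \<notin> set (butlast S)" and "Suc i < length S"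
  shows "d u (S ! i) = Suc (d u (S ! Suc i))"
  using assms(4)
proof (induction i)
  case 0
  have "S ! 0 \<in> V" "u \<noteq> S ! 0"
    using S 0 u path_nth_in_V[of S 0] unfolding stem_def set_butlast_conv_nth by (auto dest: Suc_lessD)
  then obtain x where "(x, S ! 0) \<in> E" "Suc (d u x) = d u (S ! 0)" using dist_pred u by blast
  moreover have "x = S ! 1"
    using S calculation adj_sym by (auto simp: stem_def path_def hd_conv_nth)
  ultimately show ?case by simp
next
  case (Suc i)
  have "S ! Suc i \<in> V" "u \<noteq> S ! Suc i"
    using S Suc.prems u path_nth_in_V[of S "Suc i"] unfolding stem_def set_butlast_conv_nth by auto
  then obtain x where x: "(x, S ! Suc i) \<in> E" "Suc (d u x) = d u (S ! Suc i)"
    using dist_pred u by blast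
  then have "x = S ! i \<or> x = S ! Suc (Suc i)"
    using S Suc.prems adj_sym unfolding stem_def by blast
  then show ?case using x Suc by auto
qed

lemma stem_dist_hd:
  assumes S: "stem S" and u: "u \<in> V" "u \<notin> set (butlast S)" and "i < length S"
  shows "d u (hd S) = d u (S ! i) + i"
  using assms(4)
proof (induction i)
  case 0
  then show ?case using S by (auto simp: stem_def path_def hd_conv_nth)
next
  case (Suc i)
  then show ?case using stem_dist_Suc[OF S u] by simp
qed

text \<open>Both \<open>x\<close> and \<open>y\<close> reach \<open>z = S ! i\<close> through
  \<open>S ! Suc i\<close>, so a detour to \<open>z\<close> costs two steps more than one to
  \<open>S ! Suc i\<close>.\<close>

lemma stem_not_between:
  assumes S: "stem S" and "x \<in> V" "x \<notin> set (butlast S)" "y \<in> V" "y \<notin> set (butlast S)"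
    and z: "z \<in> set (butlast S)"
  shows "d x y < d x z + d z y"
proof -
  obtain i where i: "Suc i < length S" "z = S ! i" using z set_butlast_conv_nth by metis
  let ?t = "S ! Suc i"
  have V: "z \<in> V" "?t \<in> V" using S i path_nth_in_V by (auto simp: stem_def)
  have "d x z = Suc (d x ?t)" "d y z = Suc (d y ?t)" using stem_dist_Suc S assms i by auto
  then show ?thesis using dist_tri[of x ?t y] dist_sym[of y] V assms by simp
qed

text \<open>An inner vertex of a stem has two distinct neighbours, whereas a farthest vertex has at
  most one.\<close>

lemma farthest_not_in_stem:
  assumes S: "stem S" and "v \<in> V" "\<forall>x\<in>V. d v x \<le> d v u" "u \<noteq> hd S"
  shows "u \<notin> set (butlast S)"
proof
  assume "u \<in> set (butlast S)"
  then obtain i where i: "Suc i < length S" "u = S ! i" using set_butlast_conv_nth by metis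
  with S assms(4) obtain k where k: "i = Suc k"
    by (cases i) (auto simp: stem_def path_def hd_conv_nth)
  have "(u, S ! Suc i) \<in> E" "(S ! k, u) \<in> E"
    using S i k by (auto simp: stem_def path_def)
  then have "S ! Suc i = S ! k" using farthest_neighbour_unique assms adj_sym by blast
  then show False
    using S i k nth_eq_iff_index_eq[of S "Suc i" k] by (auto simp: stem_def path_def)
qed

text \<open>Since \<open>u\<close> lies off the stem, the way from \<open>u\<close> to
  \<open>hd S\<close> passes through \<open>v\<close>. No other vertex is farther from
  \<open>hd S\<close>, as its distance is at most that of the detour through \<open>v\<close>, where
  \<open>u\<close> is farthest.\<close>

lemma farthest_from_stem:
  assumes S: "stem S" and v: "v \<in> set (butlast S)" and u: "u \<in> V" "\<forall>x\<in>V. d v x \<le> d v u"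
    and "u \<noteq> hd S"
  shows "d u (hd S) = d u v + d v (hd S)" and "\<forall>x\<in>V. d x (hd S) \<le> d u (hd S)"
proof -
  obtain i where i: "Suc i < length S" "v = S ! i" using v set_butlast_conv_nth by metis
  have p: "path S" and h: "hd S = S ! 0" using S by (auto simp: stem_def path_def hd_conv_nth)
  have V: "v \<in> V" "hd S \<in> V" using p i h path_nth_in_V by (auto simp: path_def)
  have off: "u \<notin> set (butlast S)" using farthest_not_in_stem S V u assms(5) by blast
  have vh: "d v (hd S) = i" using path_dist[OF p, of 0 i] i h V dist_sym by simp
  show eq: "d u (hd S) = d u v + d v (hd S)" using stem_dist_hd[OF S u(1) off, of i] i vh by simp
  show "\<forall>x\<in>V. d x (hd S) \<le> d u (hd S)"
  proof
    fix x assume "x \<in> V"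
    then show "d x (hd S) \<le> d u (hd S)"
      using dist_tri[of x v "hd S"] u V dist_sym[of v] eq by fastforce
  qed
qed

end

section \<open>Distances in trees\<close>

lemma vwalk_append_iff:
  "p \<noteq> [] \<Longrightarrow> q \<noteq> [] \<Longrightarrow>
    vwalk (p @ q) G \<longleftrightarrow> vwalk p G \<and> vwalk q G \<and> (last p, hd q) \<in> arcs_ends G"
  by (auto simp: vwalk_def vwalk_arcs_append)

lemma set_vwalk_arcs: "set (vwalk_arcs p) = {(p ! i, p ! Suc i) |i. Suc i < length p}"
proof (induction p rule: vwalk_arcs.induct)
  case (3 x y xs)
  have "{(zs ! i, zs ! Suc i) |i. Suc i < length zs} =
      insert (x, y) {((y # xs) ! i, (y # xs) ! Suc i) |i. Suc i < length (y # xs)}"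
    (is "?L = insert _ ?R") if zs: "zs = x # y # xs" for zs
  proof (intro set_eqI iffI)
    fix e assume "e \<in> ?L"
    then obtain i where "e = (zs ! i, zs ! Suc i)" "Suc i < length zs" by blast
    then show "e \<in> insert (x, y) ?R" unfolding zs by (cases i) auto
  next
    fix e assume "e \<in> insert (x, y) ?R"
    then consider "e = (x, y)" | i where "e = ((y # xs) ! i, (y # xs) ! Suc i)" "Suc i < length (y # xs)"
      by blast
    then show "e \<in> ?L"
    proof cases
      case 1
      then show ?thesis unfolding zs by (auto intro!: exI[of _ 0])
    next
      case (2 i)
      then show ?thesis unfolding zs by (auto intro!: exI[of _ "Suc i"])
    qed
  qed
  from this[OF refl] show ?case using 3 by simp
qed auto

lemma vwalk_iff_nth:
  "vwalk p G \<longleftrightarrow> p \<noteq> [] \<and> set p \<subseteq> verts G \<and>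
     (\<forall>i. Suc i < length p \<longrightarrow> (p ! i, p ! Suc i) \<in> arcs_ends G)"
  unfolding vwalk_def set_vwalk_arcs by blast

text \<open>Both \<open>\<mu>\<close> and \<open>cycle\<close> speak of arc walks; this carries
  vertex walks over to them by choosing an arc for each step.\<close>

lemma (in wf_digraph) vwalk_imp_awalk:
  assumes "vwalk p G"
  shows "\<exists>es. awalk (hd p) es (last p) \<and> awalk_verts (hd p) es = p"
  using assms
proof (induction p rule: vwalk_induct)
  case (Base u)
  then show ?case by (intro exI[of _ "[]"]) (simp add: awalk_Nil_iff)
next
  case (Cons u v es)
  then obtain fs where "awalk v fs (last (v # es))" "awalk_verts v fs = v # es" by auto
  moreover obtain e where "e \<in> arcs G" "tail G e = u" "head G e = v" using Cons by auto
  ultimately show ?case by (intro exI[of _ "e # fs"]) (auto simp: awalk_Cons_iff)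
qed

text \<open>A natural-number version of \<open>graph_dist\<close>, where \<open>Suc n\<close> counts
  the vertices of a walk with \<open>n\<close> edges. The value is unspecified if there is no walk,
  so lemmas about it supply one.\<close>

definition walk_dist :: "('a, 'b) pre_digraph \<Rightarrow> 'a \<Rightarrow> 'a \<Rightarrow> nat" where
  "walk_dist G u v = (LEAST n. \<exists>p. vwalk p G \<and> hd p = u \<and> last p = v \<and> length p = Suc n)"

lemma walk_dist_le:
  assumes "vwalk p G"
  shows "walk_dist G (hd p) (last p) \<le> length p - 1"
proof -
  have "length p = Suc (length p - 1)" using assms by (auto simp: vwalk_def)
  then show ?thesis unfolding walk_dist_def using assms by (intro Least_le) blast
qed

lemma shortest_vwalk_exists:
  assumes "vwalk q G" "hd q = u" "last q = v"
  shows "\<exists>p. vwalk p G \<and> hd p = u \<and> last p = v \<and> length p = Suc (walk_dist G u v)"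
proof -
  have "length q = Suc (length q - 1)" using assms by (auto simp: vwalk_def)
  then have "\<exists>n p. vwalk p G \<and> hd p = u \<and> last p = v \<and> length p = Suc n" using assms by blast
  then show ?thesis unfolding walk_dist_def by (rule LeastI_ex)
qed

lemma graph_dist_eq_walk_dist:
  assumes "wf_digraph G" and q: "vwalk q G" "hd q = u" "last q = v"
  shows "graph_dist G u v = ereal (real (walk_dist G u v))"
proof -
  interpret wf_digraph G by fact
  have cost: "awalk_cost (\<lambda>_. 1) es = real (length es)" for es
    by (induction es) simp_all
  obtain p where p: "vwalk p G" "hd p = u" "last p = v" "length p = Suc (walk_dist G u v)"
    using shortest_vwalk_exists[OF q] by blast
  obtain es where es: "awalk u es v" "awalk_verts u es = p" using vwalk_imp_awalk[OF p(1)] p by auto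
  then have les: "length es = walk_dist G u v" using p(4) length_awalk_verts[of u es] by simp
  have "walk_dist G u v \<le> length fs" if "awalk u fs v" for fs
    using walk_dist_le[OF awalk_imp_vwalk[OF that]] that length_awalk_verts[of u fs] by simp
  then show ?thesis
    unfolding graph_dist_def \<mu>_def cost using es les
    by (intro antisym INF_greatest) (auto intro: INF_lower2)
qed

lemma undirected_tree_vpath_exists:
  assumes "undirected_tree T" "u \<in> verts T" "v \<in> verts T"
  shows "\<exists>p. vpath p T \<and> hd p = u \<and> last p = v"
proof -
  interpret graph T using assms unfolding undirected_tree_def by blast
  have "strongly_connected T"
    using assms symmetric_connected_imp_strongly_connected sym_arcs unfolding undirected_tree_def by blast
  then show ?thesis using assms reachable_vpath_conv by blast
qed

lemma walk_dist_triangle: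
  assumes "vwalk p G" "hd p = x" "last p = y" "vwalk q G" "hd q = y" "last q = z"
  shows "walk_dist G x z \<le> walk_dist G x y + walk_dist G y z"
proof -
  obtain p' where p': "vwalk p' G" "hd p' = x" "last p' = y" "length p' = Suc (walk_dist G x y)"
    using shortest_vwalk_exists[OF assms(1-3)] by blast
  obtain q' where q': "vwalk q' G" "hd q' = y" "last q' = z" "length q' = Suc (walk_dist G y z)"
    using shortest_vwalk_exists[OF assms(4-6)] by blast
  show ?thesis
  \<comment> \<open>The common vertex \<open>y\<close> must occur once in the glued walk, so
    \<open>q'\<close> is appended without its head.\<close>
  proof (cases "tl q'")
    case Nil
    then show ?thesis using q' by (cases q') auto
  next
    case (Cons w r)
    then have q: "q' = y # w # r" using q' by (cases q') auto
    then have "vwalk (w # r) G" "(y, w) \<in> arcs_ends G" using q' by (auto simp: vwalk_def)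
    moreover have "p' \<noteq> []" using p' by auto
    ultimately have "vwalk (p' @ w # r) G" using p' by (simp add: vwalk_append_iff)
    then show ?thesis using walk_dist_le[of "p' @ w # r" G] p' q' q by (auto simp: hd_append)
  qed
qed

text \<open>More than three vertices in the list mean at least three arcs, hence a forbidden cycle.
  The bound still admits the walk back and forth along an edge.\<close>

lemma undirected_tree_no_polygon:
  assumes T: "undirected_tree T" and p: "vwalk p T" "hd p = last p" "distinct (tl p)"
  shows "length p \<le> 3"
proof (rule ccontr)
  assume l: "\<not> length p \<le> 3"
  interpret graph T using T unfolding undirected_tree_def by blast
  obtain es where es: "awalk (hd p) es (last p)" "awalk_verts (hd p) es = p"
    using vwalk_imp_awalk[OF p(1)] by blast
  then have "length es \<ge> 3" using l length_awalk_verts[of "hd p" es] by simp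
  moreover have "cycle es"
    unfolding cycle_def using es p calculation by (auto intro!: exI[of _ "hd p"])
  ultimately show False using T unfolding undirected_tree_def by blast
qed

text \<open>
  Up to their first common vertex the two paths close up to a cycle through \<open>u\<close>.
\<close>

lemma neighbour_vpath_avoiding_unique:
  assumes T: "undirected_tree T" and p: "vpath p T" "hd p = x" "last p = v" "u \<notin> set p"
    and q: "vpath q T" "hd q = y" "last q = v" "u \<notin> set q"
    and adj: "(u, x) \<in> arcs_ends T" "(u, y) \<in> arcs_ends T"
  shows "x = y"
proof (rule ccontr)
  assume "x \<noteq> y"
  interpret graph T using T unfolding undirected_tree_def by blast
  have "v \<in> set p" "v \<in> set q"
    using p q last_in_set[of p] last_in_set[of q] by (auto simp: vpath_def vwalk_def)
  then obtain a z b where a: "p = a @ z # b" "z \<in> set q" "\<forall>w\<in>set a. w \<notin> set q"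
    using split_list_first_prop[of p "\<lambda>w. w \<in> set q"] by blast
  then obtain c e where q': "q = c @ z # e" by (meson split_list)
  let ?r = "rev (c @ [z])"
  have vq: "vwalk ?r T" "hd ?r = z" "last ?r = y"
    using vwalk_rev_ex[OF sym_arcs, of "c @ [z]"] vwalkI_append_l[of "c @ [z]" e T] q q'
    by (auto simp: vpath_def last_rev hd_append)
  have vp: "vwalk (a @ [z]) T" "hd (a @ [z]) = x"
    using vwalkI_append_l[of "a @ [z]" b T] p a by (auto simp: vpath_def hd_append)
  have u: "u \<in> verts T" using adj adj_in_verts by blast
  have 1: "vwalk (a @ ?r) T"
  proof (cases "a = []")
    case False
    then have "vwalk a T" "(last a, z) \<in> arcs_ends T" using vp by (auto simp: vwalk_append_iff)
    then show ?thesis using False vq by (simp add: vwalk_append_iff)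
  qed (use vq in simp)
  \<comment> \<open>This follows \<open>p\<close> from \<open>x\<close> to \<open>z\<close>, then
    \<open>q\<close> backwards to \<open>y\<close>. It is distinct because \<open>z\<close> is the
    first vertex of \<open>p\<close> on \<open>q\<close>.\<close>
  define w where "w = a @ ?r"
  have w: "vwalk w T" "w \<noteq> []" "hd w = x" "last w = y" "distinct w" "u \<notin> set w"
    using 1 vp vq p q a q' by (auto simp: w_def vpath_def hd_append last_append)
  then have "vwalk (w @ [u]) T"
    using adj u arcs_ends_symmetric[OF sym_arcs] by (simp add: vwalk_append_iff)
  then have "vwalk ([u] @ w @ [u]) T" using w adj u by (subst vwalk_append_iff) auto
  then have "length ([u] @ w @ [u]) \<le> 3"
    using undirected_tree_no_polygon[OF T, of "[u] @ w @ [u]"] w by simp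
  \<comment> \<open>Between the two copies of \<open>u\<close> there is room for \<open>z\<close>
    only, so both paths start at \<open>z\<close>.\<close>
  then have "length (a @ c) = 0" by (simp add: w_def)
  then have "a = []" "c = []" by auto
  then show False using \<open>x \<noteq> y\<close> p q a q' by auto
qed

lemma tree_metric_undirected_tree:
  assumes T: "undirected_tree T"
  shows "tree_metric (verts T) (arcs_ends T) (walk_dist T)"
proof -
  interpret graph T using T unfolding undirected_tree_def by blast
  let ?d = "walk_dist T"
  have conn: "\<exists>p. vwalk p T \<and> hd p = u \<and> last p = v" if "u \<in> verts T" "v \<in> verts T" for u v
    using undirected_tree_vpath_exists[OF T that] by (auto simp: vpath_def)
  have short: "\<exists>p. vwalk p T \<and> hd p = u \<and> last p = v \<and> length p = Suc (?d u v)"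
    if V: "u \<in> verts T" "v \<in> verts T" for u v
  proof -
    obtain q where "vwalk q T" "hd q = u" "last q = v" using conn[OF V] by blast
    then show ?thesis by (rule shortest_vwalk_exists)
  qed
  have sym: "(y, x) \<in> arcs_ends T" if "(x, y) \<in> arcs_ends T" for x y
    using that arcs_ends_symmetric sym_arcs by metis
  have zero: "?d x y = 0 \<longleftrightarrow> x = y" if V: "x \<in> verts T" "y \<in> verts T" for x y
  proof
    assume "?d x y = 0"
    then obtain p where "hd p = x" "last p = y" "length p = 1" using short[OF V] by auto
    then show "x = y" by (cases p) auto
  next
    assume "x = y"
    then show "?d x y = 0" using walk_dist_le[of "[x]" T] V by simp
  qed
  have dsym_le: "?d x y \<le> ?d y x" if V: "x \<in> verts T" "y \<in> verts T" for x y
  proof -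
    obtain p where "vwalk p T" "hd p = y" "last p = x" "length p = Suc (?d y x)"
      using short V by blast
    then show ?thesis
      using walk_dist_le[OF vwalk_rev_ex[OF sym_arcs, of p]] by (simp add: hd_rev last_rev)
  qed
  have dsym: "?d x y = ?d y x" if "x \<in> verts T" "y \<in> verts T" for x y
    using dsym_le that by (meson antisym)
  have tri: "?d x z \<le> ?d x y + ?d y z" if V: "x \<in> verts T" "y \<in> verts T" "z \<in> verts T" for x y z
  proof -
    obtain p where p: "vwalk p T" "hd p = x" "last p = y" using conn V by blast
    obtain q where "vwalk q T" "hd q = y" "last q = z" using conn V by blast
    with p show ?thesis by (rule walk_dist_triangle)
  qed
  have adj1: "?d x y = 1" if a: "(x, y) \<in> arcs_ends T" for x y
  proof -
    have V: "x \<in> verts T" "y \<in> verts T" using a adj_in_verts by auto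
    have "x \<noteq> y" using a adj_not_same by blast
    moreover have "?d x y \<le> 1" using walk_dist_le[of "[x, y]" T] V a by simp
    ultimately show ?thesis using zero[OF V] by linarith
  qed
  have pred: "\<exists>x. (x, s) \<in> arcs_ends T \<and> Suc (?d u x) = ?d u s"
    if V: "u \<in> verts T" "s \<in> verts T" and "u \<noteq> s" for u s
  proof -
    obtain p where p: "vwalk p T" "hd p = u" "last p = s" "length p = Suc (?d u s)"
      using short V by blast
    then have "p = butlast p @ [s]" by (metis append_butlast_last_id vwalk_def)
    then obtain r where r: "p = r @ [s]" by blast
    have "r \<noteq> []" using r p \<open>u \<noteq> s\<close> by auto
    then have v: "vwalk r T" "(last r, s) \<in> arcs_ends T" "hd r = u"
      using p r by (auto simp: vwalk_append_iff)
    then have "Suc (?d u (last r)) \<le> ?d u s"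
      using walk_dist_le[OF v(1)] p r \<open>r \<noteq> []\<close> by (cases r) auto
    moreover have "?d u s \<le> Suc (?d u (last r))"
      using tri[of u "last r" s] V adj1[OF v(2)] adj_in_verts[OF v(2)] by simp
    ultimately show ?thesis using v by (intro exI[of _ "last r"]) auto
  qed
  \<comment> \<open>A shortest walk from \<open>v\<close> to \<open>x\<close> meets every vertex
    before its end at distance less than \<open>?d v x\<close>, so it misses \<open>u\<close>. Two
    neighbours of this kind coincide by \<open>neighbour_vpath_avoiding_unique\<close>.\<close>
  have avoid: "\<exists>p. vpath p T \<and> hd p = x \<and> last p = v \<and> u \<notin> set p"
    if v: "v \<in> verts T" and ux: "(u, x) \<in> arcs_ends T" and le: "?d v x \<le> ?d v u" for u v x
  proof -
    have V: "x \<in> verts T" "u \<in> verts T" using ux adj_in_verts by auto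
    obtain p where p: "vwalk p T" "hd p = v" "last p = x" "length p = Suc (?d v x)"
      using short v V by blast
    have "u \<notin> set p"
    proof
      assume "u \<in> set p"
      then obtain a b where ab: "p = a @ u # b" by (meson split_list)
      then have w: "vwalk (a @ [u]) T" using vwalkI_append_l[of "a @ [u]" b T] p by simp
      have "hd (a @ [u]) = v" using p ab by (auto simp: hd_append)
      then have "?d v u \<le> length a" using walk_dist_le[OF w] by simp
      moreover have "u \<noteq> x" using ux adj_not_same by blast
      then have "b \<noteq> []" using ab p by auto
      ultimately show False using le p ab by (cases b) auto
    qed
    moreover define q where "q = vwalk_to_vpath (rev p)"
    ultimately have "vpath q T" "hd q = x" "last q = v" "u \<notin> set q"
      using p vwalk_rev_ex[OF sym_arcs p(1)] vwalk_to_vpath_subset[of u "rev p"]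
      by (auto simp: vwalk_to_vpath_vpath vwalk_to_vpath_hd vwalk_to_vpath_last hd_rev last_rev)
    then show ?thesis by blast
  qed
  have nearer: "x = y" if "v \<in> verts T" "(u, x) \<in> arcs_ends T" "(u, y) \<in> arcs_ends T"
    "?d v x \<le> ?d v u" "?d v y \<le> ?d v u" for u v x y
    using avoid[OF that(1,2,4)] avoid[OF that(1,3,5)] neighbour_vpath_avoiding_unique[OF T] that(2,3) by blast
  show ?thesis
    by unfold_locales (use adj_in_verts sym zero dsym tri adj1 pred nearer in \<open>auto\<close>)
qed

section \<open>Eccentricity and diametrical paths\<close>

lemma eccentricity_le_iff:
  assumes "finite (verts G)" "v \<in> verts G"
  shows "eccentricity G v \<le> c \<longleftrightarrow> (\<forall>x\<in>verts G. graph_dist G x v \<le> c)"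
  unfolding eccentricity_def using assms by (subst Max_le_iff) auto

lemma diameter_le_iff:
  assumes "finite (verts G)" "verts G \<noteq> {}"
  shows "diameter G \<le> c \<longleftrightarrow> (\<forall>v\<in>verts G. \<forall>x\<in>verts G. graph_dist G x v \<le> c)"
  unfolding diameter_def using assms by (subst Max_le_iff) (auto simp: eccentricity_le_iff)

text \<open>The function \<open>d\<close> is left free so that the distance of \<open>T\<close> can
  be used both for \<open>T\<close> and for its induced trees.\<close>

lemma eccentric_to_iff:
  assumes "finite (verts G)" "u \<in> verts G" "v \<in> verts G"
    and dist: "\<And>x. x \<in> verts G \<Longrightarrow> graph_dist G x v = ereal (real (d x v))"
  shows "eccentric_to G u v \<longleftrightarrow> (\<forall>x\<in>verts G. d x v \<le> d u v)"
proof -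
  have "graph_dist G u v \<le> eccentricity G v"
    using eccentricity_le_iff[OF assms(1,3)] assms(2) by blast
  then have "eccentric_to G u v \<longleftrightarrow> eccentricity G v \<le> graph_dist G u v"
    unfolding eccentric_to_def by auto
  then show ?thesis unfolding eccentricity_le_iff[OF assms(1,3)] using dist assms(2) by auto
qed

lemma arcs_ends_induce_subgraph:
  "arcs_ends (G \<restriction> W) = arcs_ends G \<inter> W \<times> W"
  by (auto simp: arcs_ends_conv)

lemma vwalk_induce_subgraph_iff:
  assumes "W \<subseteq> verts G"
  shows "vwalk p (G \<restriction> W) \<longleftrightarrow> vwalk p G \<and> set p \<subseteq> W"
  using assms nth_mem[of _ p] unfolding vwalk_iff_nth arcs_ends_induce_subgraph
  by (fastforce dest: Suc_lessD)

locale tree_graph =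
  fixes T :: "('a, 'b) pre_digraph"
  assumes is_tree: "undirected_tree T"

sublocale tree_graph \<subseteq> graph T
  using is_tree unfolding undirected_tree_def by blast

sublocale tree_graph \<subseteq> M: tree_metric "verts T" "arcs_ends T" "walk_dist T"
  using is_tree by (rule tree_metric_undirected_tree)

context tree_graph
begin

lemma path_iff_vpath: "M.path p \<longleftrightarrow> vpath p T"
  unfolding M.path_def vpath_def vwalk_iff_nth by blast

lemma graph_dist_eq:
  assumes "u \<in> verts T" "v \<in> verts T"
  shows "graph_dist T u v = ereal (real (walk_dist T u v))"
proof -
  obtain p where "vwalk p T" "hd p = u" "last p = v"
    using undirected_tree_vpath_exists[OF is_tree assms] by (auto simp: vpath_def)
  with wf_digraph show ?thesis by (rule graph_dist_eq_walk_dist)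
qed

lemma eccentric_to_iff_walk_dist:
  assumes "u \<in> verts T" "v \<in> verts T"
  shows "eccentric_to T u v \<longleftrightarrow> (\<forall>x\<in>verts T. walk_dist T x v \<le> walk_dist T u v)"
  using assms graph_dist_eq by (intro eccentric_to_iff) auto

lemma vpath_ends_in_verts: "vpath P T \<Longrightarrow> hd P \<in> verts T \<and> last P \<in> verts T"
  using hd_in_set[of P] last_in_set[of P] by (auto simp: vpath_def vwalk_def)

text \<open>In a tree the length of a path is the distance between its ends, so it equals the
  diameter exactly when the ends are a diametral pair.\<close>

lemma diametrical_path_iff:
  "diametrical_path T P \<longleftrightarrow> vpath P T \<and> M.diametral (hd P) (last P)"
proof (cases "vpath P T")
  case True
  let ?a = "hd P" and ?b = "last P"
  have V: "?a \<in> verts T" "?b \<in> verts T" using vpath_ends_in_verts True by auto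
  then have ne: "verts T \<noteq> {}" by auto
  have "graph_dist T ?a ?b \<le> diameter T"
    using diameter_le_iff[OF finite_verts ne, of "diameter T"] V by blast
  then have "graph_dist T ?a ?b = diameter T \<longleftrightarrow> diameter T \<le> graph_dist T ?a ?b" by auto
  also have "\<dots> \<longleftrightarrow> M.diametral ?a ?b"
    unfolding diameter_le_iff[OF finite_verts ne] M.diametral_def using V graph_dist_eq by auto
  also have "graph_dist T ?a ?b = ereal (real (vwalk_length P))"
    using graph_dist_eq[OF V] M.path_dist_ends True path_iff_vpath by simp
  finally show ?thesis unfolding diametrical_path_def using True by simp
qed (simp add: diametrical_path_def)

lemma diametrical_path_exists:
  assumes "M.diametral a b"
  shows "\<exists>P. diametrical_path T P \<and> hd P = a \<and> last P = b"
  using undirected_tree_vpath_exists[OF is_tree, of a b] assms diametrical_path_iff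
  by (auto simp: M.diametral_def)

lemma diametral_sym: "M.diametral a b \<Longrightarrow> M.diametral b a"
  using M.dist_sym[of a b] by (simp add: M.diametral_def)

lemma diametrical_path_from:
  assumes "v \<in> {hd Q, last Q}" "diametrical_path T Q"
  shows "\<exists>c. M.diametral v c"
  using assms diametrical_path_iff diametral_sym by auto

section \<open>Stems and induced trees\<close>

lemma card_neighbours_le:
  assumes "finite X" "\<And>x. x \<in> X \<Longrightarrow> (u, x) \<in> arcs_ends T"
  shows "card X \<le> out_degree T u"
proof -
  have "X \<subseteq> head T ` out_arcs T u"
    using assms(2) by (fastforce simp: arcs_ends_conv)
  then have "card X \<le> card (head T ` out_arcs T u)" by (intro card_mono) auto
  also have "\<dots> \<le> out_degree T u" unfolding out_degree_def by (intro card_image_le) auto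
  finally show ?thesis .
qed

text \<open>The leaf has one neighbour. Since \<open>last S\<close> is a nearest branch vertex, the
  inner vertices have degree at most two, and their neighbours on \<open>S\<close> already account
  for that.\<close>

lemma is_stem_imp_stem:
  assumes leaf: "leaf T v" and S: "is_stem T v S"
  shows "M.stem S" and "hd S = v"
proof -
  show hd: "hd S = v" using S by (simp add: is_stem_def)
  have p: "M.path S" using S path_iff_vpath by (simp add: is_stem_def)
  then have ne: "S \<noteq> []" and D: "distinct S"
    and adj: "\<And>i. Suc i < length S \<Longrightarrow> (S ! i, S ! Suc i) \<in> arcs_ends T"
    by (auto simp: M.path_def)
  have "hd S \<noteq> last S" using leaf S by (auto simp: leaf_def is_stem_def branch_vertex_def)
  then have l: "2 \<le> length S" using ne by (cases S) (auto simp: Suc_le_eq)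
  have nb: "\<not> branch_vertex T (S ! i)" if i: "Suc i < length S" for i
  proof
    assume b: "branch_vertex T (S ! i)"
    have V: "S ! i \<in> verts T" "last S \<in> verts T" "v \<in> verts T"
      using M.path_nth_in_V[OF p] i leaf S by (auto simp: leaf_def is_stem_def branch_vertex_def)
    have "walk_dist T v (last S) \<le> walk_dist T v (S ! i)"
      using S b graph_dist_eq V by (auto simp: is_stem_def)
    moreover have "walk_dist T v (last S) = length S - 1"
      using M.path_dist_ends[OF p] hd by simp
    moreover have "walk_dist T v (S ! i) = i"
      using M.path_dist[OF p, of 0 i] i hd ne by (simp add: hd_conv_nth)
    ultimately show False using i by simp
  qed
  have "x = S ! 1" if x: "(hd S, x) \<in> arcs_ends T" for x
  proof (rule ccontr)
    assume "x \<noteq> S ! 1"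
    moreover have "(hd S, S ! 1) \<in> arcs_ends T" using adj[of 0] l ne by (simp add: hd_conv_nth)
    ultimately show False
      using card_neighbours_le[of "{x, S ! 1}" "hd S"] x leaf hd by (auto simp: leaf_def)
  qed
  moreover have "x = S ! i \<or> x = S ! Suc (Suc i)"
    if i: "Suc (Suc i) < length S" and x: "(S ! Suc i, x) \<in> arcs_ends T" for i x
  proof (rule ccontr)
    assume "\<not> ?thesis"
    moreover have "S ! i \<noteq> S ! Suc (Suc i)" using D i by (simp add: nth_eq_iff_index_eq)
    ultimately have "card {x, S ! i, S ! Suc (Suc i)} = 3" by auto
    moreover have "(S ! Suc i, S ! i) \<in> arcs_ends T" using adj[of i] i M.adj_sym by simp
    then have "card {x, S ! i, S ! Suc (Suc i)} \<le> out_degree T (S ! Suc i)"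
      using adj[OF i] x by (intro card_neighbours_le) auto
    moreover have "S ! Suc i \<in> verts T" using x adj_in_verts by blast
    ultimately show False using nb[OF i] by (simp add: branch_vertex_def)
  qed
  ultimately show "M.stem S" using p l unfolding M.stem_def by blast
qed

section \<open>Induced trees as convex subgraphs\<close>

lemma mem_induced_tree_iff:
  "x \<in> verts (induced_tree T P) \<longleftrightarrow> x \<in> verts T \<and>
     (\<forall>v S. v \<in> removed_leaves T P \<longrightarrow> is_stem T v S \<longrightarrow> x \<notin> set (butlast S))"
  unfolding induced_tree_def by auto

lemma removed_leaf_stem:
  assumes "v \<in> removed_leaves T P" "is_stem T v S"
  shows "M.stem S" "hd S = v" "v \<noteq> hd P" "v \<noteq> last P"
  using assms is_stem_imp_stem[of v S] by (auto simp: removed_leaves_def)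

lemma induced_tree_convex:
  assumes "x \<in> verts (induced_tree T P)" "y \<in> verts (induced_tree T P)" "z \<in> verts T"
    and "walk_dist T x z + walk_dist T z y = walk_dist T x y"
  shows "z \<in> verts (induced_tree T P)"
  unfolding mem_induced_tree_iff
proof (intro conjI allI impI notI)
  fix v S assume v: "v \<in> removed_leaves T P" "is_stem T v S" and z: "z \<in> set (butlast S)"
  have "walk_dist T x y < walk_dist T x z + walk_dist T z y"
    using assms v z removed_leaf_stem(1)[OF v] mem_induced_tree_iff
    by (intro M.stem_not_between[of S]) blast+
  then show False using assms by simp
qed fact

text \<open>Each end is farthest from the other, so it could lie on a removed stem only as its leaf,
  and the ends of \<open>P\<close> are not among \<open>removed_leaves\<close>.\<close>

lemma diametrical_path_ends_in_induced_tree: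
  assumes "diametrical_path T P"
  shows "hd P \<in> verts (induced_tree T P)" "last P \<in> verts (induced_tree T P)"
proof -
  have far: "c \<in> verts (induced_tree T P)" if "M.diametral e c" "c = hd P \<or> c = last P" for c e
    unfolding mem_induced_tree_iff
  proof (intro conjI allI impI)
    show "c \<in> verts T" using that by (simp add: M.diametral_def)
    fix v S assume v: "v \<in> removed_leaves T P" "is_stem T v S"
    show "c \<notin> set (butlast S)"
      using removed_leaf_stem[OF v] that
      by (intro M.farthest_not_in_stem[of S e]) (auto simp: M.diametral_def)
  qed
  have "M.diametral (hd P) (last P)" using assms diametrical_path_iff by blast
  then show "hd P \<in> verts (induced_tree T P)" "last P \<in> verts (induced_tree T P)"
    using far diametral_sym by blast+
qed

text \<open>By convexity the path of \<open>T\<close> between the two vertices survives in the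
  induced tree; conversely, every walk there is a walk of \<open>T\<close>.\<close>

lemma graph_dist_induced_tree:
  assumes x: "x \<in> verts (induced_tree T P)" and y: "y \<in> verts (induced_tree T P)"
  shows "graph_dist (induced_tree T P) x y = ereal (real (walk_dist T x y))"
proof -
  define W where "W = verts (induced_tree T P)"
  have W: "induced_tree T P = T \<restriction> W" "W \<subseteq> verts T"
    unfolding W_def by (auto simp: induced_tree_def)
  have V: "x \<in> verts T" "y \<in> verts T" using x y W unfolding W_def by auto
  obtain p where p: "vpath p T" "hd p = x" "last p = y"
    using undirected_tree_vpath_exists[OF is_tree V] by blast
  then have Mp: "M.path p" and ne: "p \<noteq> []" using path_iff_vpath by (auto simp: M.path_def)
  have lp: "length p - 1 = walk_dist T x y" using M.path_dist_ends[OF Mp] p by simp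
  have "set p \<subseteq> W"
  proof
    fix z assume "z \<in> set p"
    then obtain i where i: "i < length p" "z = p ! i" by (metis in_set_conv_nth)
    then have "walk_dist T x z = i" "walk_dist T z y = length p - 1 - i"
      using M.path_dist[OF Mp, of 0 i] M.path_dist[OF Mp, of i "length p - 1"] p ne
      by (auto simp: hd_conv_nth last_conv_nth)
    then have "walk_dist T x z + walk_dist T z y = walk_dist T x y" using lp i by simp
    then show "z \<in> W"
      using induced_tree_convex x y M.path_nth_in_V[OF Mp i(1)] i(2) unfolding W_def by blast
  qed
  then have pW: "vwalk p (T \<restriction> W)" using p vwalk_induce_subgraph_iff[OF W(2)] by (simp add: vpath_def)
  obtain q where q: "vwalk q (T \<restriction> W)" "hd q = x" "last q = y"
      "length q = Suc (walk_dist (T \<restriction> W) x y)"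
    using shortest_vwalk_exists[OF pW p(2,3)] by blast
  then have "walk_dist T x y \<le> walk_dist (T \<restriction> W) x y"
    using walk_dist_le[of q T] vwalk_induce_subgraph_iff[OF W(2)] by simp
  moreover have "walk_dist (T \<restriction> W) x y \<le> walk_dist T x y"
    using walk_dist_le[OF pW] p lp by simp
  moreover have "graph_dist (T \<restriction> W) x y = ereal (real (walk_dist (T \<restriction> W) x y))"
    using wellformed_induce_subgraph pW p(2,3) by (rule graph_dist_eq_walk_dist)
  ultimately show ?thesis unfolding W(1) by simp
qed

text \<open>The largest distance from \<open>v\<close> is attained at an end of \<open>P\<close>,
  and both ends belong to the induced tree.\<close>

lemma eccentric_to_induced_tree_iff:
  assumes P: "diametrical_path T P"
    and u: "u \<in> verts (induced_tree T P)" and v: "v \<in> verts (induced_tree T P)"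
  shows "eccentric_to (induced_tree T P) u v \<longleftrightarrow> eccentric_to T u v"
proof -
  let ?W = "verts (induced_tree T P)" and ?d = "walk_dist T"
  have W: "?W \<subseteq> verts T" by (auto simp: mem_induced_tree_iff)
  have fin: "finite ?W" using W finite_verts by (rule finite_subset)
  have diam: "M.diametral (hd P) (last P)" using P diametrical_path_iff by blast
  note ends = diametrical_path_ends_in_induced_tree[OF P]
  have "?d x v \<le> ?d u v" if "\<forall>x\<in>?W. ?d x v \<le> ?d u v" "x \<in> verts T" for x
  proof -
    have V: "hd P \<in> verts T" "last P \<in> verts T" "v \<in> verts T" using ends v W by auto
    have "?d (hd P) v \<le> ?d u v" "?d (last P) v \<le> ?d u v" using that(1) ends by auto
    then show ?thesis
      using M.dist_le_max_diametral[OF diam V(3) that(2)]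
      unfolding M.dist_sym[OF V(3) V(1)] M.dist_sym[OF V(3) V(2)] M.dist_sym[OF V(3) that(2)]
      by linarith
  qed
  then have "(\<forall>x\<in>?W. ?d x v \<le> ?d u v) \<longleftrightarrow> (\<forall>x\<in>verts T. ?d x v \<le> ?d u v)" using W by blast
  moreover have "eccentric_to (induced_tree T P) u v \<longleftrightarrow> (\<forall>x\<in>?W. ?d x v \<le> ?d u v)"
    using fin u v graph_dist_induced_tree by (intro eccentric_to_iff) auto
  moreover have "eccentric_to T u v \<longleftrightarrow> (\<forall>x\<in>verts T. ?d x v \<le> ?d u v)"
    using u v W by (intro eccentric_to_iff_walk_dist) auto
  ultimately show ?thesis by simp
qed

lemma eccentric_to_in_induced_tree:
  assumes V: "u \<in> verts T" "v \<in> verts T" and ecc: "eccentric_to T u v"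
  shows "\<exists>P. diametrical_path T P \<and> u \<in> verts (induced_tree T P) \<and> v \<in> verts (induced_tree T P)"
proof -
  let ?d = "walk_dist T"
  have far: "\<forall>x\<in>verts T. ?d v x \<le> ?d v u"
    using ecc eccentric_to_iff_walk_dist[OF V] M.dist_sym V by auto
  obtain a b where "M.diametral a b" using M.diametral_exists V by blast
  then obtain c where c: "M.diametral u c" using M.farthest_diametral far V by blast
  show ?thesis
  proof (cases "\<exists>w S. leaf T w \<and> is_stem T w S \<and> v \<in> set (butlast S) \<and> w \<noteq> u \<and>
      (\<exists>e. M.diametral w e)")
    case True
    then obtain w S e where w: "leaf T w" "is_stem T w S" "v \<in> set (butlast S)" "w \<noteq> u"
      "M.diametral w e" by blast
    note S = is_stem_imp_stem[OF w(1,2)]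
    have we: "w \<in> verts T" "e \<in> verts T" using w by (auto simp: M.diametral_def)
    \<comment> \<open>The second part makes \<open>u\<close> at least as far from \<open>w\<close>
      as \<open>e\<close> is, so \<open>u\<close> can replace \<open>e\<close> in the diametral
      pair. The first part puts \<open>v\<close> between the ends of the new path.\<close>
    have thru: "?d u w = ?d u v + ?d v w" "?d e w \<le> ?d u w"
      using M.farthest_from_stem[OF S(1) w(3) V(1) far] S(2) w(4) we by auto
    then have "M.diametral u w"
      using w(5) V we M.dist_sym[of w e] unfolding M.diametral_def by (metis order_trans)
    then obtain P where P: "diametrical_path T P" "hd P = u" "last P = w"
      using diametrical_path_exists by blast
    note ends = diametrical_path_ends_in_induced_tree[OF P(1)]
    have "v \<in> verts (induced_tree T P)"
      using induced_tree_convex[OF ends] V P thru(1) by simp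
    then show ?thesis using P ends by blast
  next
    case False
    obtain P where P: "diametrical_path T P" "hd P = u" "last P = c"
      using diametrical_path_exists c by blast
    \<comment> \<open>A removed leaf ends a diametrical path and differs from \<open>u\<close>, an
      end of \<open>P\<close>; with \<open>v\<close> on its stem it would fall under the first
      case.\<close>
    have "v \<in> verts (induced_tree T P)"
      unfolding mem_induced_tree_iff
    proof (intro conjI allI impI notI)
      fix w S assume w: "w \<in> removed_leaves T P" "is_stem T w S" "v \<in> set (butlast S)"
      then have "leaf T w" "w \<noteq> u" "\<exists>e. M.diametral w e"
        using P diametrical_path_from by (auto simp: removed_leaves_def)
      then show False using False w by blast
    qed fact
    then show ?thesis using P diametrical_path_ends_in_induced_tree[OF P(1)] by blast
  qed
qed

end

theorem theorem1:
  fixes T :: "('a, 'b) pre_digraph"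
  assumes "undirected_tree T"
    and "card (verts T) \<ge> 2"
  shows "eccentric_graph T =
    pair_Union ((\<lambda>P. eccentric_graph (induced_tree T P)) ` {P. diametrical_path T P})"
proof -
  interpret tree_graph T by unfold_locales fact
  have sub: "verts (induced_tree T P) \<subseteq> verts T" for P by (auto simp: mem_induced_tree_iff)
  \<comment> \<open>Every vertex has some vertex eccentric to it, so the lemma that covers the edges
    also covers the vertex set.\<close>
  have far: "\<exists>u\<in>verts T. eccentric_to T u v" if v: "v \<in> verts T" for v
  proof -
    have "eccentricity T v \<in> (\<lambda>u. graph_dist T u v) ` verts T"
      unfolding eccentricity_def using v by (intro Max_in) auto
    then show ?thesis unfolding eccentric_to_def by force
  qed
  have "verts T = (\<Union>P\<in>{P. diametrical_path T P}. verts (induced_tree T P))"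
  proof (intro subset_antisym subsetI)
    fix v assume v: "v \<in> verts T"
    then obtain u where "u \<in> verts T" "eccentric_to T u v" using far by blast
    with v show "v \<in> (\<Union>P\<in>{P. diametrical_path T P}. verts (induced_tree T P))"
      using eccentric_to_in_induced_tree[of u v] by blast
  qed (use sub in blast)
  moreover have "parcs (eccentric_graph T) =
      (\<Union>P\<in>{P. diametrical_path T P}. parcs (eccentric_graph (induced_tree T P)))"
    (is "?L = ?R")
  proof (intro subset_antisym subrelI)
    fix u v assume "(u, v) \<in> ?L"
    then have uv: "u \<in> verts T" "v \<in> verts T" "u \<noteq> v" "eccentric_to T u v \<or> eccentric_to T v u"
      by (auto simp: eccentric_graph_def)
    then obtain P where P: "diametrical_path T P"
        "u \<in> verts (induced_tree T P)" "v \<in> verts (induced_tree T P)"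
      using eccentric_to_in_induced_tree[of u v] eccentric_to_in_induced_tree[of v u] by blast
    then have "(u, v) \<in> parcs (eccentric_graph (induced_tree T P))"
      using uv eccentric_to_induced_tree_iff[OF P] eccentric_to_induced_tree_iff[OF P(1,3,2)]
      by (simp add: eccentric_graph_def)
    then show "(u, v) \<in> ?R" using P by blast
  next
    fix u v assume "(u, v) \<in> ?R"
    then obtain P where P: "diametrical_path T P"
        and "(u, v) \<in> parcs (eccentric_graph (induced_tree T P))" by blast
    then have uv: "u \<in> verts (induced_tree T P)" "v \<in> verts (induced_tree T P)" "u \<noteq> v"
        "eccentric_to (induced_tree T P) u v \<or> eccentric_to (induced_tree T P) v u"
      by (auto simp: eccentric_graph_def)
    then have "u \<in> verts T" "v \<in> verts T" using sub by auto
    then show "(u, v) \<in> ?L"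
      using uv eccentric_to_induced_tree_iff[OF P] by (auto simp: eccentric_graph_def)
  qed
  ultimately show ?thesis by (simp add: eccentric_graph_def pair_Union_def)
qed

end
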